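(* Let $\mathcal{G}$ be a finite group with left regular representation $\rho_{\mathrm{reg}}$. Then $$\bigcup_{k \in \mathcal{K}} \Pi_k \subseteq \mathrm{HS}(\rho_{\mathrm{reg}}(\mathcal{G})) \subseteq \mathrm{Co} \left( \bigcup_{k \in \mathcal{K}} \Pi_k \right),$$ in which $\mathcal{K}$ is the set of positive integers $k$ such that some $g \in \mathcal{G}$ has order $k$.
   Context: $\mathrm{Co}(X)$ denotes the convex hull of $X$, i.e. the set of all (finite) convex combinations of elements of $X$, for $X$ a set of matrices (linear operators) or of complex numbers. For a set $S$ of $n\times n$ complex matrices (or linear operators on a finite-dimensional complex vector space), the hull spectrum $\mathrm{HS}(S)\subseteq\mathbb{C}$ is the set of all complex numbers that occur as eigenvalues of some element of $\mathrm{Co}(S)$. $\Pi_k$ denotes the convex hull in $\mathbb{C}$ of the $k$th roots of unity. The left regular representation is $\rho_{\mathrm{reg}}:\mathcal{G}\to GL(V_{\mathrm{reg}})$, where $V_{\mathrm{reg}}$ is the vector space of all functions $\mathcal{G}\to\mathbb{C}$ and $(\rho_{\mathrm{reg}}(g)f)(g')=f(g^{-1}g')$; $\rho_{\mathrm{reg}}(\mathcal{G})$ denotes its image. *)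

theory Defs
  imports
    "HOL-Analysis.Analysis"
    "HOL-Algebra.Multiplicative_Group"
    "HOL-Library.Function_Algebras"
begin

(* Pointwise real scalar multiplication, so that the library notion of convex hull
   applies to sets of operators on a function space. *)

instantiation "fun" :: (type, real_vector) real_vector
begin

definition scaleR_fun :: "real \<Rightarrow> ('a \<Rightarrow> 'b) \<Rightarrow> 'a \<Rightarrow> 'b"
  where "scaleR_fun r f = (\<lambda>x. r *\<^sub>R f x)"

instance
  by standard (simp_all add: scaleR_fun_def fun_eq_iff scaleR_right_distrib scaleR_left_distrib)

end

(* Operators on a subspace V of 'a \<Rightarrow> complex are represented by total maps on 'a \<Rightarrow> complex, of
   which only the restriction to V matters; eigenvectors are therefore required to lie in V. *)

definition is_eigenvalue_on ::
  "('a \<Rightarrow> complex) set \<Rightarrow> (('a \<Rightarrow> complex) \<Rightarrow> ('a \<Rightarrow> complex)) \<Rightarrow> complex \<Rightarrow> bool"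
  where "is_eigenvalue_on V T c \<longleftrightarrow> (\<exists>f\<in>V. f \<noteq> 0 \<and> T f = (\<lambda>x. c * f x))"

definition hull_spectrum ::
  "('a \<Rightarrow> complex) set \<Rightarrow> (('a \<Rightarrow> complex) \<Rightarrow> ('a \<Rightarrow> complex)) set \<Rightarrow> complex set"
  where "hull_spectrum V S = {c. \<exists>T \<in> convex hull S. is_eigenvalue_on V T c}"

definition root_polygon :: "nat \<Rightarrow> complex set"
  where "root_polygon k = convex hull {z. z ^ k = 1}"

(* A function on the group is a function on the ambient type vanishing off the carrier. *)

definition V_reg :: "('a, 'b) monoid_scheme \<Rightarrow> ('a \<Rightarrow> complex) set"
  where "V_reg G = {f. \<forall>x. x \<notin> carrier G \<longrightarrow> f x = 0}"

definition reg_rep ::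
  "('a, 'b) monoid_scheme \<Rightarrow> 'a \<Rightarrow> ('a \<Rightarrow> complex) \<Rightarrow> ('a \<Rightarrow> complex)"
  where "reg_rep G g f =
    (\<lambda>x. if x \<in> carrier G then f (inv\<^bsub>G\<^esub> g \<otimes>\<^bsub>G\<^esub> x) else 0)"

lemma reg_rep_in_V_reg: "reg_rep G g f \<in> V_reg G"
  by (simp add: reg_rep_def V_reg_def)

lemma reg_rep_one:
  assumes "group G" "f \<in> V_reg G"
  shows "reg_rep G \<one>\<^bsub>G\<^esub> f = f"
proof -
  interpret group G by fact
  show ?thesis using assms(2) by (auto simp: reg_rep_def V_reg_def fun_eq_iff)
qed

lemma reg_rep_mult:
  assumes "group G" "g \<in> carrier G" "h \<in> carrier G"
  shows "reg_rep G (g \<otimes>\<^bsub>G\<^esub> h) f = reg_rep G g (reg_rep G h f)"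
proof -
  interpret group G by fact
  show ?thesis using assms(2,3)
    by (auto simp: reg_rep_def fun_eq_iff inv_mult_group m_assoc)
qed

definition element_orders :: "('a, 'b) monoid_scheme \<Rightarrow> nat set"
  where "element_orders G = {k. 0 < k \<and> (\<exists>g \<in> carrier G. group.ord G g = k)}"

end

theory Submission
  imports Defs
begin

text \<open>
  If \<open>g\<close> has order \<open>k\<close> and \<open>\<omega>\<close> is a primitive \<open>k\<close>th root of unity, then
  \<open>g\<^sup>m \<mapsto> \<omega>\<^sup>-\<^sup>m\<close>, extended by zero, is an eigenvector of every \<open>\<rho>(g\<^sup>j)\<close>, with eigenvalue \<open>\<omega>\<^sup>j\<close>.
  The eigenvalues that hull elements have on this fixed vector form a convex set, so they include
  all of \<open>\<Pi>\<^sub>k\<close>.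

  Conversely, if \<open>T f = c f\<close> then \<open>c\<close> is the Rayleigh quotient of \<open>T\<close> at \<open>f\<close>, which is affine in
  \<open>T\<close>. It remains to see that the Rayleigh quotient of \<open>\<rho>(g)\<close> lies in \<open>\<Pi>\<^sub>k\<close> for \<open>g\<close> of order \<open>k\<close>.
  The sum over a \<open>\<langle>g\<rangle>\<close>-orbit is the correlation of a \<open>k\<close>-periodic sequence with its shift, and by
  the discrete Fourier transform this is a combination of \<open>k\<close>th roots of unity with weights
  proportional to the squared moduli of the Fourier coefficients.
\<close>

section \<open>Roots of unity and the discrete Fourier transform\<close>

text \<open>Primitivity is put as a criterion on exponents, the form that
  \<open>ord_pow_eq_iff\<close> has for group elements, so that equalities of powers transfer
  between g and \<omega>.\<close>

lemma primitive_root_of_unity_exists: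
  assumes "0 < k"
  obtains \<omega> :: complex
  where "\<And>m n. \<omega> ^ m = \<omega> ^ n \<longleftrightarrow> m mod k = n mod k"
    and "\<And>z. z ^ k = 1 \<Longrightarrow> \<exists>j. z = \<omega> ^ j"
    and "cmod \<omega> = 1"
proof
  define \<omega> where "\<omega> = exp (2 * of_real pi * \<i> / of_nat k)"
  have pow: "\<omega> ^ j = exp (2 * of_real pi * \<i> * of_nat j / of_nat k)" for j
    by (simp add: \<omega>_def mult_ac flip: exp_of_nat_mult)
  show "\<omega> ^ m = \<omega> ^ n \<longleftrightarrow> m mod k = n mod k" for m n
    using assms complex_root_unity_eq[of k m n] by (simp add: pow)
  show "\<exists>j. z = \<omega> ^ j" if "z ^ k = 1" for z
    using assms complex_roots_unity[of k] that by (auto simp: pow)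
  show "cmod \<omega> = 1"
    by (simp add: \<omega>_def)
qed

lemma sum_powers_root_of_unity:
  fixes z :: "'a::field"
  assumes "z ^ k = 1"
  shows "(\<Sum>j<k. z ^ j) = (if z = 1 then of_nat k else 0)"
  using assms by (simp add: sum_gp_strict)

text \<open>Expanding the squared modulus gives a double sum over m and l, in which orthogonality of
  the characters keeps only m = l + s modulo k. The case s = 0 is Parseval's identity; the factor k
  comes from the unnormalised transform.\<close>

lemma shifted_correlation_fourier:
  fixes u :: "nat \<Rightarrow> complex"
  assumes "0 < k"
    and prim: "\<And>m n. \<omega> ^ m = \<omega> ^ n \<longleftrightarrow> m mod k = n mod k"
    and norm: "cmod \<omega> = 1"
    and periodic: "\<And>m. u (m mod k) = u m"
  shows "(\<Sum>j<k. \<omega> ^ (s * j) * of_real ((cmod (\<Sum>m<k. u m * cnj (\<omega> ^ m) ^ j))\<^sup>2))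
         = of_nat k * (\<Sum>l<k. u (l + s) * cnj (u l))"
proof -
  have root: "\<omega> ^ k = 1"
    using prim[of k 0] by simp
  have unit: "\<omega> ^ n * cnj (\<omega> ^ n) = 1" for n
    by (simp add: complex_norm_square[symmetric] norm norm_power del: complex_cnj_power)
  have sq: "of_real ((cmod (\<Sum>m<k. u m * cnj (\<omega> ^ m) ^ j))\<^sup>2)
      = (\<Sum>m<k. \<Sum>l<k. u m * cnj (u l) * (\<omega> ^ l * cnj (\<omega> ^ m)) ^ j)" for j
    unfolding complex_norm_square
    by (simp add: sum_product power_mult_distrib mult_ac)
  \<comment> \<open>A geometric sum whose ratio \<open>?z\<close> is a k-th root of unity: it
    vanishes unless \<open>?z = 1\<close>. The residue appears because m stays below k while l + s
    may not.\<close>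
  have ortho: "(\<Sum>j<k. \<omega> ^ (s * j) * (\<omega> ^ l * cnj (\<omega> ^ m)) ^ j)
      = (if m = (l + s) mod k then of_nat k else 0)" if "m < k" for l m
  proof -
    let ?z = "\<omega> ^ (l + s) * cnj (\<omega> ^ m)"
    have "?z = 1 \<longleftrightarrow> \<omega> ^ (l + s) = \<omega> ^ m"
      using unit[of m] by (metis mult.commute mult.assoc mult_1 mult_1_right)
    also have "\<dots> \<longleftrightarrow> m = (l + s) mod k"
      using that by (auto simp: prim)
    finally have z1: "?z = 1 \<longleftrightarrow> m = (l + s) mod k" .
    have "?z ^ k = (\<omega> ^ k) ^ (l + s) * cnj ((\<omega> ^ k) ^ m)"
      by (simp add: power_mult_distrib mult.commute flip: power_mult)
    then have "?z ^ k = 1"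
      by (simp add: root)
    moreover have "\<omega> ^ (s * j) * (\<omega> ^ l * cnj (\<omega> ^ m)) ^ j = ?z ^ j" for j
      by (simp add: power_mult_distrib power_add mult_ac flip: power_mult)
    ultimately show ?thesis
      using sum_powers_root_of_unity[of ?z k] by (simp only: z1)
  qed
  have "(\<Sum>j<k. \<omega> ^ (s * j) * of_real ((cmod (\<Sum>m<k. u m * cnj (\<omega> ^ m) ^ j))\<^sup>2))
      = (\<Sum>j<k. \<Sum>m<k. \<Sum>l<k.
          u m * cnj (u l) * (\<omega> ^ (s * j) * (\<omega> ^ l * cnj (\<omega> ^ m)) ^ j))"
    unfolding sq sum_distrib_left by (simp only: mult_ac)
  also have "\<dots> = (\<Sum>m<k. \<Sum>l<k. \<Sum>j<k.
          u m * cnj (u l) * (\<omega> ^ (s * j) * (\<omega> ^ l * cnj (\<omega> ^ m)) ^ j))"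
    by (subst sum.swap) (intro sum.cong refl sum.swap)
  also have "\<dots> = (\<Sum>m<k. \<Sum>l<k. u m * cnj (u l) * (if m = (l + s) mod k then of_nat k else 0))"
    by (intro sum.cong refl, subst sum_distrib_left[symmetric], subst ortho) auto
  also have "\<dots> = (\<Sum>l<k. \<Sum>m<k. u m * cnj (u l) * (if m = (l + s) mod k then of_nat k else 0))"
    by (rule sum.swap)
  also have "\<dots> = (\<Sum>l<k. u (l + s) * cnj (u l) * of_nat k)"
    using \<open>0 < k\<close> by (simp add: if_distrib sum.delta periodic cong: if_cong)
  finally show ?thesis
    by (simp add: sum_distrib_left mult_ac)
qed

section \<open>Powers and translations in a group\<close>

lemma (in group) ord_pow_eq_iff:
  fixes m n :: nat
  assumes "x \<in> carrier G"
  shows "x [^] m = x [^] n \<longleftrightarrow> m mod ord x = n mod ord x"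
proof -
  have "x [^] m = x [^] n \<longleftrightarrow> int (ord x) dvd int n - int m"
    using int_pow_eq[OF assms, of "int m" "int n"] by (simp add: int_pow_int)
  also have "\<dots> \<longleftrightarrow> int n mod int (ord x) = int m mod int (ord x)"
    by (simp add: mod_eq_dvd_iff)
  also have "\<dots> \<longleftrightarrow> m mod ord x = n mod ord x"
    by (metis of_nat_eq_iff zmod_int)
  finally show ?thesis .
qed

lemma (in group) sum_left_translate:
  assumes "a \<in> carrier G"
  shows "(\<Sum>x\<in>carrier G. h (a \<otimes> x)) = (\<Sum>x\<in>carrier G. h x)"
  using sum.reindex[OF inj_on_cmult[OF assms], of h] surj_const_mult[OF assms] by simp

section \<open>First inclusion: a common eigenvector for the powers of g\<close>

lemma (in group) root_polygon_subset_hull_spectrum: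
  assumes g: "g \<in> carrier G" and pos: "0 < ord g"
  shows "root_polygon (ord g) \<subseteq> hull_spectrum (V_reg G) (reg_rep G ` carrier G)"
proof -
  obtain \<omega> :: complex
    where prim: "\<And>m n. \<omega> ^ m = \<omega> ^ n \<longleftrightarrow> m mod ord g = n mod ord g"
      and gen: "\<And>z. z ^ ord g = 1 \<Longrightarrow> \<exists>j. z = \<omega> ^ j"
      and norm: "cmod \<omega> = 1"
    using primitive_root_of_unity_exists[OF pos] by metis
  have \<omega>0: "\<omega> \<noteq> 0"
    using norm by auto
  \<comment> \<open>The exponent chosen by \<open>SOME\<close> matters only modulo
    \<open>ord g\<close>, so f is well defined on the powers of g. The inverse is needed because
    \<rho>(g) lowers the exponent by one, which then multiplies f by \<omega>.\<close>
  define f where "f x = (if \<exists>m::nat. x = g [^] m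
      then inverse \<omega> ^ (SOME m::nat. x = g [^] m) else 0)" for x
  have f_pow: "f (g [^] m) = inverse \<omega> ^ m" for m :: nat
  proof -
    have "g [^] m = g [^] (SOME n::nat. g [^] m = g [^] n)"
      by (rule someI) simp
    then have "\<omega> ^ m = \<omega> ^ (SOME n::nat. g [^] m = g [^] n)"
      unfolding ord_pow_eq_iff[OF g] prim by simp
    then show ?thesis
      by (auto simp: f_def power_inverse)
  qed
  have V: "f \<in> V_reg G"
    using g by (auto simp: V_reg_def f_def)
  have "f \<one> = 1"
    using f_pow[of 0] by simp
  then have nz: "f \<noteq> 0"
    by auto
  have shift: "f (inv g \<otimes> x) = \<omega> * f x" if x: "x \<in> carrier G" for x
  proof (cases "\<exists>m::nat. x = g [^] m")
    case True
    then obtain m :: nat where m: "x = g [^] m" by blast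
    \<comment> \<open>Adding \<open>ord g\<close> keeps the exponent positive, so that subtracting
      one is genuine even for m = 0.\<close>
    have "x = g [^] (m + ord g)"
      using g m by (simp add: ord_pow_eq_iff)
    also have "\<dots> = g [^] Suc (m + ord g - 1)"
      using pos by simp
    finally have xs: "x = g [^] Suc (m + ord g - 1)" .
    then have "inv g \<otimes> x = g [^] (m + ord g - 1)"
      using g x by (metis inv_solve_left' nat_pow_Suc2 nat_pow_closed)
    then show ?thesis
      using f_pow[of "Suc (m + ord g - 1)"] xs \<omega>0 by (simp add: f_pow)
  next
    case False
    \<comment> \<open>Translation by \<open>inv g\<close> cannot lead into the powers of g from
      outside, so both sides of the eigenvalue equation vanish here.\<close>
    have "\<nexists>m::nat. inv g \<otimes> x = g [^] m"
    proof
      assume "\<exists>m::nat. inv g \<otimes> x = g [^] m"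
      then obtain m :: nat where "inv g \<otimes> x = g [^] m" by blast
      then have "x = g [^] Suc m"
        using g x by (metis inv_solve_left' nat_pow_Suc2 nat_pow_closed)
      with False show False by blast
    qed
    with False show ?thesis
      by (simp add: f_def)
  qed
  have eig: "reg_rep G (g [^] j) f = (\<lambda>x. \<omega> ^ j * f x)" for j :: nat
  proof (induction j)
    case 0
    show ?case
      using reg_rep_one[OF is_group V] by simp
  next
    case (Suc j)
    have "reg_rep G (g [^] Suc j) f = reg_rep G g (\<lambda>x. \<omega> ^ j * f x)"
      using g reg_rep_mult[OF is_group g, of "g [^] j" f]
      unfolding nat_pow_Suc2[OF g] Suc by simp
    also have "\<dots> = (\<lambda>x. \<omega> ^ Suc j * f x)"
      using V by (auto simp: reg_rep_def V_reg_def fun_eq_iff shift)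
    finally show ?case .
  qed
  let ?H = "convex hull (reg_rep G ` carrier G)"
  let ?C = "{c. \<exists>T\<in>?H. T f = (\<lambda>x. c * f x)}"
  have "convex ?C"
  proof (rule convexI)
    fix c d :: complex and a b :: real
    assume "c \<in> ?C" "d \<in> ?C" and ab: "0 \<le> a" "0 \<le> b" "a + b = 1"
    then obtain S T where ST: "S \<in> ?H" "S f = (\<lambda>x. c * f x)" "T \<in> ?H" "T f = (\<lambda>x. d * f x)"
      by blast
    have "a *\<^sub>R S + b *\<^sub>R T \<in> ?H"
      using ST ab convexD[OF convex_convex_hull] by blast
    moreover have "(a *\<^sub>R S + b *\<^sub>R T) f = (\<lambda>x. (a *\<^sub>R c + b *\<^sub>R d) * f x)"
      by (simp add: scaleR_fun_def ST fun_eq_iff algebra_simps)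
    ultimately show "a *\<^sub>R c + b *\<^sub>R d \<in> ?C"
      by blast
  qed
  moreover have "{z. z ^ ord g = 1} \<subseteq> ?C"
  proof
    fix z :: complex assume "z \<in> {z. z ^ ord g = 1}"
    then obtain j where "z = \<omega> ^ j"
      using gen by auto
    moreover have "reg_rep G (g [^] j) \<in> ?H"
      using g by (intro hull_inc imageI) simp
    ultimately show "z \<in> ?C"
      using eig by auto
  qed
  ultimately have "root_polygon (ord g) \<subseteq> ?C"
    unfolding root_polygon_def by (intro hull_minimal)
  also have "?C \<subseteq> hull_spectrum (V_reg G) (reg_rep G ` carrier G)"
    using V nz by (auto simp: hull_spectrum_def is_eigenvalue_on_def)
  finally show ?thesis .
qed

section \<open>Second inclusion: Rayleigh quotients\<close>

text \<open>No orbit representatives are chosen: every x in the group starts its own periodic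
  sequence \<open>u x\<close>, so each orbit is counted once for each of its k points. This only
  rescales the weights.\<close>

lemma (in group) reg_rep_rayleigh_quotient:
  assumes fin: "finite (carrier G)" and g: "g \<in> carrier G"
    and N: "(\<Sum>x\<in>carrier G. (cmod (f x))\<^sup>2) = N" "N > 0"
  shows "(\<Sum>x\<in>carrier G. reg_rep G g f x * cnj (f x)) / of_real N \<in> root_polygon (ord g)"
proof -
  define k where "k = ord g"
  have pos: "0 < k"
    using ord_ge_1[OF fin g] by (simp add: k_def)
  obtain \<omega> :: complex
    where prim: "\<And>m n. \<omega> ^ m = \<omega> ^ n \<longleftrightarrow> m mod k = n mod k" and norm: "cmod \<omega> = 1"
    using primitive_root_of_unity_exists[OF pos] by metis
  define u where "u x m = f (inv g [^] m \<otimes> x)" for x and m :: nat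
  have periodic: "u x (m mod k) = u x m" for x m
  proof -
    have "inv g [^] (m mod k) = inv g [^] m"
      using g by (simp add: ord_pow_eq_iff k_def)
    then show ?thesis
      by (simp add: u_def)
  qed
  \<comment> \<open>One factor k undoes the unnormalised Fourier transform, the other the k-fold
    count of each orbit; N is the denominator of the Rayleigh quotient.\<close>
  define w where "w j = (\<Sum>x\<in>carrier G. (cmod (\<Sum>m<k. u x m * cnj (\<omega> ^ m) ^ j))\<^sup>2)
      / (real k * real k * N)" for j
  \<comment> \<open>Substituting x for \<open>inv g [^] m \<otimes> x\<close> removes the dependence
    on m.\<close>
  have translate: "(\<Sum>x\<in>carrier G. u x (m + s) * cnj (u x m))
      = (\<Sum>x\<in>carrier G. f (inv g [^] s \<otimes> x) * cnj (f x))" for m s :: nat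
  proof -
    have "inv g [^] (m + s) \<otimes> x = inv g [^] s \<otimes> (inv g [^] m \<otimes> x)" if "x \<in> carrier G" for x
      using g that by (simp add: add.commute[of m s] flip: nat_pow_mult m_assoc)
    then have "(\<Sum>x\<in>carrier G. u x (m + s) * cnj (u x m))
        = (\<Sum>x\<in>carrier G. f (inv g [^] s \<otimes> (inv g [^] m \<otimes> x)) * cnj (f (inv g [^] m \<otimes> x)))"
      by (intro sum.cong) (simp_all add: u_def)
    also have "\<dots> = (\<Sum>x\<in>carrier G. f (inv g [^] s \<otimes> x) * cnj (f x))"
      using g by (intro sum_left_translate[where h = "\<lambda>y. f (inv g [^] s \<otimes> y) * cnj (f y)"]) simp
    finally show ?thesis .
  qed
  \<comment> \<open>Stated for every s because two values are wanted: s = 0 shows that the weights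
    sum to 1, and s = 1 gives the Rayleigh quotient of \<rho>(g).\<close>
  have moment: "(\<Sum>j<k. of_real (w j) * \<omega> ^ (s * j))
      = (\<Sum>x\<in>carrier G. f (inv g [^] s \<otimes> x) * cnj (f x)) / of_real N" for s
  proof -
    have w_scale: "of_real (w j) * z * of_real (real k * real k * N) = (\<Sum>x\<in>carrier G.
        z * of_real ((cmod (\<Sum>m<k. u x m * cnj (\<omega> ^ m) ^ j))\<^sup>2))" for j and z :: complex
      using pos N(2) by (simp add: w_def flip: sum_distrib_left)
    have "(\<Sum>j<k. of_real (w j) * \<omega> ^ (s * j)) * of_real (real k * real k * N)
        = (\<Sum>j<k. \<Sum>x\<in>carrier G.
            \<omega> ^ (s * j) * of_real ((cmod (\<Sum>m<k. u x m * cnj (\<omega> ^ m) ^ j))\<^sup>2))"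
      unfolding sum_distrib_right w_scale ..
    also have "\<dots> = (\<Sum>x\<in>carrier G. of_nat k * (\<Sum>m<k. u x (m + s) * cnj (u x m)))"
      by (subst sum.swap)
        (simp only: shifted_correlation_fourier[OF pos prim norm, where u = "u x" for x, OF periodic])
    also have "\<dots> = of_nat k * (\<Sum>m<k. \<Sum>x\<in>carrier G. u x (m + s) * cnj (u x m))"
      by (subst sum.swap) (simp add: sum_distrib_left)
    also have "\<dots> = of_nat k * of_nat k
        * (\<Sum>x\<in>carrier G. f (inv g [^] s \<otimes> x) * cnj (f x))"
      by (simp add: translate)
    finally show ?thesis
      using pos N(2) by (simp add: field_simps)
  qed
  have "(\<Sum>x\<in>carrier G. f x * cnj (f x)) = of_real N"
    unfolding N(1)[symmetric] of_real_sum complex_norm_square ..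
  then have "of_real (\<Sum>j<k. w j) = (1 :: complex)"
    using moment[of 0] N(2) by simp
  then have w1: "(\<Sum>j<k. w j) = 1"
    using of_real_eq_1_iff by blast
  have "\<omega> ^ j \<in> root_polygon k" for j
  proof -
    have "(\<omega> ^ j) ^ k = \<omega> ^ 0"
      unfolding power_mult[symmetric] prim by simp
    then show ?thesis
      unfolding root_polygon_def by (intro hull_inc) simp
  qed
  then have "(\<Sum>j<k. w j *\<^sub>R \<omega> ^ j) \<in> root_polygon k"
    using w1 N(2) unfolding root_polygon_def
    by (intro convex_sum) (auto simp: w_def intro!: divide_nonneg_nonneg sum_nonneg)
  moreover have "(\<Sum>x\<in>carrier G. reg_rep G g f x * cnj (f x))
      = (\<Sum>x\<in>carrier G. f (inv g [^] (1::nat) \<otimes> x) * cnj (f x))"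
    using g by (intro sum.cong) (simp_all add: reg_rep_def)
  ultimately show ?thesis
    using moment[of 1] by (simp add: scaleR_conv_of_real k_def)
qed

text \<open>The eigenvector f of a single hull element T stays fixed while the operator varies. The
  operators whose quotient at f lies in the convex target form a convex set, so it suffices to check
  the generators, although f need not be an eigenvector of any of them.\<close>

lemma (in group) hull_spectrum_subset:
  assumes fin: "finite (carrier G)"
  shows "hull_spectrum (V_reg G) (reg_rep G ` carrier G)
    \<subseteq> convex hull (\<Union>k \<in> element_orders G. root_polygon k)"
    (is "_ \<subseteq> ?P")
proof
  fix c assume "c \<in> hull_spectrum (V_reg G) (reg_rep G ` carrier G)"
  then obtain T f where T: "T \<in> convex hull (reg_rep G ` carrier G)"
    and f: "f \<in> V_reg G" "f \<noteq> 0" "T f = (\<lambda>x. c * f x)"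
    by (auto simp: hull_spectrum_def is_eigenvalue_on_def)
  define N where "N = (\<Sum>x\<in>carrier G. (cmod (f x))\<^sup>2)"
  obtain y where "f y \<noteq> 0" "y \<in> carrier G"
    using f(1,2) by (auto simp: fun_eq_iff V_reg_def)
  then have N: "N > 0"
    unfolding N_def using fin by (intro sum_pos2[of _ y]) auto
  define q where "q S = (\<Sum>x\<in>carrier G. S f x * cnj (f x)) / of_real N"
    for S :: "('a \<Rightarrow> complex) \<Rightarrow> 'a \<Rightarrow> complex"
  have q_lin: "q (a *\<^sub>R S + b *\<^sub>R S') = a *\<^sub>R q S + b *\<^sub>R q S'" for a b S S'
    by (simp add: q_def scaleR_fun_def scaleR_conv_of_real sum.distrib sum_distrib_left
        add_divide_distrib algebra_simps)
  have "convex {S. q S \<in> ?P}"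
  proof (rule convexI)
    fix S S' and a b :: real
    assume "S \<in> {S. q S \<in> ?P}" "S' \<in> {S. q S \<in> ?P}" "0 \<le> a" "0 \<le> b" "a + b = 1"
    then show "a *\<^sub>R S + b *\<^sub>R S' \<in> {S. q S \<in> ?P}"
      using convexD[OF convex_convex_hull] by (simp add: q_lin)
  qed
  moreover have "reg_rep G ` carrier G \<subseteq> {S. q S \<in> ?P}"
  proof clarsimp
    fix g assume g: "g \<in> carrier G"
    then have "ord g \<in> element_orders G"
      using ord_ge_1[OF fin g] by (auto simp: element_orders_def)
    moreover have "q (reg_rep G g) \<in> root_polygon (ord g)"
      unfolding q_def using reg_rep_rayleigh_quotient[OF fin g _ N] N_def by simp
    ultimately show "q (reg_rep G g) \<in> ?P"
      by (intro hull_inc) blast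
  qed
  ultimately have "q T \<in> ?P"
    using T hull_minimal by blast
  moreover have "(\<Sum>x\<in>carrier G. f x * cnj (f x)) = of_real N"
    unfolding N_def of_real_sum complex_norm_square ..
  then have "q T = c"
    using N by (simp add: q_def f(3) mult.assoc flip: sum_distrib_left)
  ultimately show "c \<in> ?P"
    by simp
qed

theorem corollary4p7:
  fixes G :: "('a, 'b) monoid_scheme"
  assumes "group G" and "finite (carrier G)"
  shows "(\<Union>k \<in> element_orders G. root_polygon k)
           \<subseteq> hull_spectrum (V_reg G) (reg_rep G ` carrier G)
      \<and> hull_spectrum (V_reg G) (reg_rep G ` carrier G)
           \<subseteq> convex hull (\<Union>k \<in> element_orders G. root_polygon k)"
proof -
  interpret group G by fact
  have "(\<Union>k \<in> element_orders G. root_polygon k)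
      \<subseteq> hull_spectrum (V_reg G) (reg_rep G ` carrier G)"
    using root_polygon_subset_hull_spectrum by (fastforce simp: element_orders_def)
  then show ?thesis
    using hull_spectrum_subset[OF assms(2)] by blast
qed

end
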